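(* Let $S$ be a left cancellative semigroup with unit and $A$ a C*-algebra. There is a one-to-one correspondence between injective actions of $S$ with ideal images on $A$ and unital actions of $S^*$ on $A$.
   Context: $S^*$ is the inverse semigroup generated by elements $v_p$ ($p\in S$) subject to $v_pv_q=v_{pq}$ and $v_p^*v_p=1$ (quotient of the free inverse semigroup on $\{v_p:p\in S\}$, unit $v_1=1$). An injective action with ideal images of $S$ on $A$ is a family of injective *-homomorphisms $\alpha_s\colon A\to A$ ($s\in S$) with $\alpha_{st}=\alpha_s\alpha_t$ and such that each $\alpha_s(A)$ is a closed two-sided *-ideal in $A$. A partial automorphism of $A$ is a *-isomorphism $\phi\colon J_1\to J_2$ between closed two-sided *-ideals of $A$. The partial automorphisms form an inverse semigroup $\mathcal I(A)$ under composition on the largest possible domain (if $\phi,\psi$ have domains $Y,Z$, then $\phi\psi$ has domain $\psi^{-1}(\psi(Z)\cap Y)$), with the inverse map as inverse. An action of an inverse semigroup $P$ on $A$ is a *-homomorphism $P\to\mathcal I(A)$, $s\mapsto(\alpha_s\colon E_{s^*}\to E_s)$, such that the union of all $E_s$ is $A$; if $P$ has a unit $1$, the action is unital if $\alpha_1=\mathrm{id}_A$. *)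

theory Defs
  imports "HOL-Analysis.Analysis"
begin

class star =
  fixes star :: "'a \<Rightarrow> 'a"


section \<open>C*-algebras\<close>

text \<open>Algebras need not be unital, and the zero algebra is allowed.\<close>

class scaleC = scaleR +
  fixes scaleC :: "complex \<Rightarrow> 'a \<Rightarrow> 'a" (infixr "*\<^sub>C" 75)
  assumes scaleR_scaleC: "scaleR r x = complex_of_real r *\<^sub>C x"

class complex_vector = scaleC + ab_group_add +
  assumes scaleC_add_right: "a *\<^sub>C (x + y) = a *\<^sub>C x + a *\<^sub>C y"
    and scaleC_add_left: "(a + b) *\<^sub>C x = a *\<^sub>C x + b *\<^sub>C x"
    and scaleC_scaleC: "a *\<^sub>C (b *\<^sub>C x) = (a * b) *\<^sub>C x"
    and scaleC_one: "1 *\<^sub>C x = x"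

class complex_algebra = complex_vector + ring +
  assumes mult_scaleC_left: "(a *\<^sub>C x) * y = a *\<^sub>C (x * y)"
    and mult_scaleC_right: "x * (a *\<^sub>C y) = a *\<^sub>C (x * y)"

class complex_normed_algebra = complex_algebra + real_normed_algebra +
  assumes norm_scaleC: "norm (a *\<^sub>C x) = cmod a * norm x"

class cstar_algebra = complex_normed_algebra + banach + star +
  assumes cstar_add: "star (x + y) = star x + star y"
    and cstar_scaleC: "star (a *\<^sub>C x) = cnj a *\<^sub>C star x"
    and cstar_mult: "star (x * y) = star y * star x"
    and cstar_star: "star (star x) = x"
    and cstar_norm: "norm (star x * x) = (norm x)\<^sup>2"

definition closed_star_ideal :: "'a::cstar_algebra set \<Rightarrow> bool" where
  "closed_star_ideal J \<longleftrightarrow>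
     closed J \<and> 0 \<in> J \<and>
     (\<forall>x\<in>J. \<forall>y\<in>J. x + y \<in> J) \<and>
     (\<forall>c. \<forall>x\<in>J. c *\<^sub>C x \<in> J) \<and>
     (\<forall>a. \<forall>x\<in>J. a * x \<in> J \<and> x * a \<in> J) \<and>
     (\<forall>x\<in>J. star x \<in> J)"

definition star_hom_on :: "'a::cstar_algebra set \<Rightarrow> ('a \<Rightarrow> 'a) \<Rightarrow> bool" where
  "star_hom_on J f \<longleftrightarrow>
     (\<forall>x\<in>J. \<forall>y\<in>J. f (x + y) = f x + f y) \<and>
     (\<forall>c. \<forall>x\<in>J. f (c *\<^sub>C x) = c *\<^sub>C f x) \<and>
     (\<forall>x\<in>J. \<forall>y\<in>J. f (x * y) = f x * f y) \<and>
     (\<forall>x\<in>J. f (star x) = star (f x))"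


section \<open>Inverse semigroups\<close>

class inverse_semigroup = semigroup_mult + star +
  assumes mult_star_mult: "x * star x * x = x"
    and star_mult_star: "star x * x * star x = star x"
    and star_unique: "x * y * x = x \<Longrightarrow> y * x * y = y \<Longrightarrow> y = star x"

text \<open>The equational axioms of inverse semigroups used below to construct the free one
  imply uniqueness of inverses.\<close>

lemma inverse_semigroup_equations:
  fixes x y :: "'a::{semigroup_mult, star}"
  assumes anti: "\<And>x y :: 'a. star (x * y) = star y * star x"
    and invol: "\<And>x :: 'a. star (star x) = x"
    and reg: "\<And>x :: 'a. x * star x * x = x"
    and comm: "\<And>x y :: 'a. (x * star x) * (y * star y) = (y * star y) * (x * star x)"
    and xyx: "x * y * x = x" and yxy: "y * x * y = y"
  shows "y = star x"
proof -
  have idem: "e * star e = e" if e: "e * e = e" for e :: 'a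
  proof -
    have se: "star e * star e = star e"
      using anti[of e e] e by simp
    have "e = e * star e * e" using reg[of e] by simp
    also have "\<dots> = (e * star e) * (star e * star (star e))"
      using se by (metis invol mult.assoc)
    also have "\<dots> = (star e * star (star e)) * (e * star e)" by (rule comm)
    also have "\<dots> = star e * (e * e) * star e" by (simp add: invol mult.assoc)
    also have "\<dots> = star e" using e reg[of "star e"] by (simp add: invol)
    finally show ?thesis using e by simp
  qed
  have ic: "e * f = f * e" if "e * e = e" "f * f = f" for e f :: 'a
    using comm[of e f] idem that by simp
  define z where "z = star x"
  have xzx: "x * z * x = x" using reg by (simp add: z_def)
  have zxz: "z * x * z = z" using reg[of z] by (simp add: z_def invol)
  have i: "(x * z) * (x * z) = x * z" "(x * y) * (x * y) = x * y"
    "(y * x) * (y * x) = y * x" "(z * x) * (z * x) = z * x"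
    using xzx zxz xyx yxy by (metis mult.assoc)+
  have "y = y * ((x * z) * (x * y))" using xzx yxy by (metis mult.assoc)
  also have "\<dots> = y * ((x * y) * (x * z))" using ic[OF i(1,2)] by simp
  also have "\<dots> = y * x * z" using yxy by (metis mult.assoc)
  also have "\<dots> = ((y * x) * (z * x)) * z" using zxz by (metis mult.assoc)
  also have "\<dots> = ((z * x) * (y * x)) * z" using ic[OF i(3,4)] by simp
  also have "\<dots> = z" using xyx zxz by (metis mult.assoc)
  finally show ?thesis by (simp add: z_def)
qed


subsection \<open>The free inverse semigroup\<close>

text \<open>Formal terms modulo the equational theory of inverse semigroups.\<close>

datatype 'g inv_term =
  Gen 'g | Mul "'g inv_term" "'g inv_term" | Star "'g inv_term"

inductive inv_eq :: "'g inv_term \<Rightarrow> 'g inv_term \<Rightarrow> bool" where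
  refl: "inv_eq a a"
| sym: "inv_eq a b \<Longrightarrow> inv_eq b a"
| trans: "inv_eq a b \<Longrightarrow> inv_eq b c \<Longrightarrow> inv_eq a c"
| Mul_cong: "inv_eq a a' \<Longrightarrow> inv_eq b b' \<Longrightarrow> inv_eq (Mul a b) (Mul a' b')"
| Star_cong: "inv_eq a a' \<Longrightarrow> inv_eq (Star a) (Star a')"
| assoc: "inv_eq (Mul (Mul a b) c) (Mul a (Mul b c))"
| Star_Mul: "inv_eq (Star (Mul a b)) (Mul (Star b) (Star a))"
| Star_Star: "inv_eq (Star (Star a)) a"
| regular: "inv_eq (Mul (Mul a (Star a)) a) a"
| commute: "inv_eq (Mul (Mul a (Star a)) (Mul b (Star b)))
                   (Mul (Mul b (Star b)) (Mul a (Star a)))"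

quotient_type 'g free_inverse_semigroup = "'g inv_term" / inv_eq
  by (rule equivpI) (auto intro!: reflpI sympI transpI intro: inv_eq.refl inv_eq.sym inv_eq.trans)

lift_definition free_gen :: "'g \<Rightarrow> 'g free_inverse_semigroup" is Gen .

instantiation free_inverse_semigroup :: (type) "{times, star}"
begin

lift_definition times_free_inverse_semigroup ::
  "'a free_inverse_semigroup \<Rightarrow> 'a free_inverse_semigroup \<Rightarrow> 'a free_inverse_semigroup"
  is Mul by (rule inv_eq.Mul_cong)

lift_definition star_free_inverse_semigroup ::
  "'a free_inverse_semigroup \<Rightarrow> 'a free_inverse_semigroup"
  is Star by (rule inv_eq.Star_cong)

instance ..

end

lemma free_inverse_semigroup_equations:
  fixes x y z :: "'g free_inverse_semigroup"
  shows free_assoc: "x * y * z = x * (y * z)"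
    and free_star_mult: "star (x * y) = star y * star x"
    and free_star_star: "star (star x) = x"
    and free_regular: "x * star x * x = x"
    and free_commute: "(x * star x) * (y * star y) = (y * star y) * (x * star x)"
  by (transfer, rule inv_eq.assoc inv_eq.Star_Mul inv_eq.Star_Star inv_eq.regular
        inv_eq.commute)+

instance free_inverse_semigroup :: (type) semigroup_mult
  by standard (rule free_assoc)

instance free_inverse_semigroup :: (type) inverse_semigroup
proof
  fix x y :: "'a free_inverse_semigroup"
  show "x * star x * x = x"
    by (rule free_regular)
  show "star x * x * star x = star x"
    using free_regular[of "star x"] by (simp add: free_star_star)
  show "y = star x" if "x * y * x = x" "y * x * y = y"
    using free_star_mult free_star_star free_regular free_commute that
    by (rule inverse_semigroup_equations)
qed


subsection \<open>The inverse semigroup generated by a monoid of isometries\<close>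

text \<open>The congruence on the free inverse semigroup generated by
  \<open>v\<^sub>p v\<^sub>q = v\<^sub>p\<^sub>q\<close> and \<open>v\<^sub>p\<^sup>* v\<^sub>p = v\<^sub>1\<close>. That \<open>v\<^sub>1\<close> is then a unit for the whole quotient
  is a consequence, established in the \<open>monoid_mult\<close> instance below.\<close>

inductive isometry_cong ::
  "'s::monoid_mult free_inverse_semigroup \<Rightarrow> 's free_inverse_semigroup \<Rightarrow> bool" where
  refl: "isometry_cong a a"
| sym: "isometry_cong a b \<Longrightarrow> isometry_cong b a"
| trans: "isometry_cong a b \<Longrightarrow> isometry_cong b c \<Longrightarrow> isometry_cong a c"
| mult_cong: "isometry_cong a a' \<Longrightarrow> isometry_cong b b' \<Longrightarrow> isometry_cong (a * b) (a' * b')"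
| star_cong: "isometry_cong a a' \<Longrightarrow> isometry_cong (star a) (star a')"
| gen_mult: "isometry_cong (free_gen p * free_gen q) (free_gen (p * q))"
| gen_isometry: "isometry_cong (star (free_gen p) * free_gen p) (free_gen 1)"

quotient_type (overloaded) 's semigroup_star =
  "'s::monoid_mult free_inverse_semigroup" / isometry_cong
  by (rule equivpI)
    (auto intro!: reflpI sympI transpI
      intro: isometry_cong.refl isometry_cong.sym isometry_cong.trans)

lift_definition gen :: "'s::monoid_mult \<Rightarrow> 's semigroup_star" is free_gen .

instantiation semigroup_star :: (monoid_mult) "{times, star, one}"
begin

lift_definition times_semigroup_star ::
  "'a semigroup_star \<Rightarrow> 'a semigroup_star \<Rightarrow> 'a semigroup_star"
  is times by (rule isometry_cong.mult_cong)

lift_definition star_semigroup_star :: "'a semigroup_star \<Rightarrow> 'a semigroup_star"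
  is star by (rule isometry_cong.star_cong)

definition one_semigroup_star :: "'a semigroup_star" where
  "1 = gen 1"

instance ..

end

lemma semigroup_star_equations:
  fixes x y z :: "'s::monoid_mult semigroup_star"
  shows semigroup_star_assoc: "x * y * z = x * (y * z)"
    and semigroup_star_star_mult: "star (x * y) = star y * star x"
    and semigroup_star_star_star: "star (star x) = x"
    and semigroup_star_regular: "x * star x * x = x"
    and semigroup_star_commute:
      "(x * star x) * (y * star y) = (y * star y) * (x * star x)"
  by (transfer, metis free_inverse_semigroup_equations isometry_cong.refl)+

lemma gen_mult: "gen p * gen q = gen (p * q)"
  by transfer (rule isometry_cong.gen_mult)

lemma star_gen_gen: "star (gen p) * gen p = 1"
  unfolding one_semigroup_star_def by transfer (rule isometry_cong.gen_isometry)

instance semigroup_star :: (monoid_mult) semigroup_mult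
  by standard (rule semigroup_star_assoc)

instance semigroup_star :: (monoid_mult) inverse_semigroup
proof
  fix x y :: "'a semigroup_star"
  show "x * star x * x = x"
    by (rule semigroup_star_regular)
  show "star x * x * star x = star x"
    using semigroup_star_regular[of "star x"] by (simp add: semigroup_star_star_star)
  show "y = star x" if "x * y * x = x" "y * x * y = y"
    using semigroup_star_star_mult semigroup_star_star_star semigroup_star_regular
      semigroup_star_commute that
    by (rule inverse_semigroup_equations)
qed

lemma free_inverse_semigroup_induct:
  assumes "\<And>p. P (free_gen p)"
    and "\<And>x y. P x \<Longrightarrow> P y \<Longrightarrow> P (x * y)"
    and "\<And>x. P x \<Longrightarrow> P (star x)"
  shows "P x"
proof -
  have "P (abs_free_inverse_semigroup t)" for t
    by (induction t)
      (use assms in \<open>auto simp flip: free_gen.abs_eq times_free_inverse_semigroup.abs_eq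
        star_free_inverse_semigroup.abs_eq\<close>)
  then show ?thesis
    by (metis Quotient_abs_rep Quotient_free_inverse_semigroup)
qed

lemma semigroup_star_induct:
  fixes x :: "'s::monoid_mult semigroup_star"
  assumes "\<And>p. P (gen p)"
    and "\<And>x y. P x \<Longrightarrow> P y \<Longrightarrow> P (x * y)"
    and "\<And>x. P x \<Longrightarrow> P (star x)"
  shows "P x"
proof -
  have "P (abs_semigroup_star t)" for t
    by (induction t rule: free_inverse_semigroup_induct)
      (use assms in \<open>auto simp flip: gen.abs_eq times_semigroup_star.abs_eq
        star_semigroup_star.abs_eq\<close>)
  then show ?thesis
    by (metis Quotient_abs_rep Quotient_semigroup_star)
qed

instance semigroup_star :: (monoid_mult) monoid_mult
proof
  fix x :: "'a semigroup_star"
  have star_one: "star (1 :: 'a semigroup_star) = 1"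
    by (metis gen_mult mult_1 one_semigroup_star_def semigroup_star_star_mult
        semigroup_star_star_star star_gen_gen)
  have "1 * x = x \<and> x * 1 = x"
  proof (induction x rule: semigroup_star_induct)
    case (1 p)
    then show ?case by (simp add: one_semigroup_star_def gen_mult)
  next
    case (2 x y)
    then show ?case by (metis semigroup_star_assoc)
  next
    case (3 x)
    then show ?case by (metis semigroup_star_star_mult star_one)
  qed
  then show "1 * x = x" "x * 1 = x" by simp_all
qed


section \<open>Actions\<close>

definition injective_ideal_action :: "('s::monoid_mult \<Rightarrow> 'a::cstar_algebra \<Rightarrow> 'a) \<Rightarrow> bool" where
  "injective_ideal_action \<alpha> \<longleftrightarrow>
     (\<forall>s. star_hom_on UNIV (\<alpha> s) \<and> inj (\<alpha> s) \<and> closed_star_ideal (range (\<alpha> s))) \<and>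
     (\<forall>s t. \<alpha> (s * t) = \<alpha> s \<circ> \<alpha> t)"

text \<open>Partial automorphisms are modelled as partial functions, so that composition on the
  largest possible domain is \<^const>\<open>map_comp\<close>.\<close>

definition partial_automorphism :: "('a::cstar_algebra \<rightharpoonup> 'a) \<Rightarrow> bool" where
  "partial_automorphism \<phi> \<longleftrightarrow>
     closed_star_ideal (dom \<phi>) \<and> closed_star_ideal (ran \<phi>) \<and>
     inj_on \<phi> (dom \<phi>) \<and> star_hom_on (dom \<phi>) (\<lambda>x. the (\<phi> x))"

definition partial_inverse :: "('a \<rightharpoonup> 'a) \<Rightarrow> ('a \<rightharpoonup> 'a)" where
  "partial_inverse \<phi> = (\<lambda>y. if y \<in> ran \<phi> then Some (THE x. \<phi> x = Some y) else None)"

text \<open>In the usual notation \<open>E\<^sub>s = ran (\<beta> s)\<close>.\<close>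

definition inverse_semigroup_action ::
  "('p::inverse_semigroup \<Rightarrow> 'a::cstar_algebra \<rightharpoonup> 'a) \<Rightarrow> bool" where
  "inverse_semigroup_action \<beta> \<longleftrightarrow>
     (\<forall>s. partial_automorphism (\<beta> s)) \<and>
     (\<forall>s t. \<beta> (s * t) = \<beta> s \<circ>\<^sub>m \<beta> t) \<and>
     (\<forall>s. \<beta> (star s) = partial_inverse (\<beta> s)) \<and>
     (\<Union>s. ran (\<beta> s)) = UNIV"

definition unital_action ::
  "('p::{inverse_semigroup, monoid_mult} \<Rightarrow> 'a::cstar_algebra \<rightharpoonup> 'a) \<Rightarrow> bool" where
  "unital_action \<beta> \<longleftrightarrow> inverse_semigroup_action \<beta> \<and> \<beta> 1 = Some"

text \<open>Restriction of an action to the generators \<open>v\<^sub>p\<close>, read as a family of total maps; this is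
  meaningful only if each \<open>\<beta> (gen p)\<close> is everywhere defined.\<close>

definition action_on_generators ::
  "('s::monoid_mult semigroup_star \<Rightarrow> 'a \<rightharpoonup> 'a) \<Rightarrow> 's \<Rightarrow> 'a \<Rightarrow> 'a" where
  "action_on_generators \<beta> p x = the (\<beta> (gen p) x)"

end

theory Submission
  imports Defs
begin

text \<open>Since \<open>v\<^sub>p\<^sup>* v\<^sub>p = 1\<close> acts as the identity, each \<open>v\<^sub>p\<close> acts by a total map, and the \<open>v\<^sub>p\<close> generate
  \<open>S\<^sup>*\<close>, so a unital action is determined by its restriction to them. Conversely an injective
  action extends to words in the \<open>v\<^sub>p\<close> and \<open>v\<^sub>p\<^sup>*\<close>, and the defining relations hold for partial
  injections. The analytic point is that partial automorphisms are closed under composition: the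
  preimage of a closed ideal under a *-homomorphism defined on a closed ideal is again a closed
  ideal of the whole algebra. This uses that *-homomorphisms are contractive and that a closed
  ideal containing \<open>y\<^sup>* y\<close> contains \<open>y\<close>; both are derived from the C*-identity by fixed point
  arguments, without spectral theory.\<close>


section \<open>Elementary C*-algebra theory\<close>

lemma scaleC_zero_right [simp]: "c *\<^sub>C (0::'a::complex_vector) = 0"
  using scaleC_add_right[of c 0 0] by simp

lemma scaleC_minus_right: "c *\<^sub>C (- x) = - (c *\<^sub>C (x::'a::complex_vector))"
  using scaleC_add_right[of c x "- x"] by (simp add: eq_neg_iff_add_eq_0 add.commute)

lemma scaleC_diff_right: "c *\<^sub>C (x - y) = c *\<^sub>C x - c *\<^sub>C (y::'a::complex_vector)"
  using scaleC_add_right[of c x "- y"] by (simp add: scaleC_minus_right)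

lemma scaleC_minus_one: "(- 1) *\<^sub>C x = - (x::'a::complex_normed_algebra)"
  using scaleR_scaleC[of "- 1" x] by simp

lemma scaleC_minus_left: "(- c) *\<^sub>C x = - (c *\<^sub>C (x::'a::complex_normed_algebra))"
  by (metis mult_minus1 scaleC_minus_one scaleC_scaleC)

lemma star_zero [simp]: "star 0 = (0::'a::cstar_algebra)"
  using cstar_add[of 0 "0::'a"] by simp

lemma star_minus: "star (- x) = - star (x::'a::cstar_algebra)"
  using cstar_add[of x "- x"] by (simp add: eq_neg_iff_add_eq_0 add.commute)

lemma star_diff: "star (x - y) = star x - star (y::'a::cstar_algebra)"
  using cstar_add[of x "- y"] by (simp add: star_minus)

lemma star_scaleR: "star (r *\<^sub>R x) = r *\<^sub>R star (x::'a::cstar_algebra)"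
  by (simp add: scaleR_scaleC cstar_scaleC)

text \<open>Submultiplicativity and the C*-identity give one inequality for every element; applying
  it to \<open>star x\<close> gives the other.\<close>

lemma norm_star: "norm (star x) = norm (x::'a::cstar_algebra)"
proof -
  have le: "norm y \<le> norm (star y)" for y :: 'a
  proof (cases "y = 0")
    case False
    have "norm y * norm y \<le> norm (star y) * norm y"
      using norm_mult_ineq[of "star y" y] by (simp add: cstar_norm power2_eq_square)
    then show ?thesis using False by simp
  qed simp
  from le[of x] le[of "star x"] show ?thesis by (simp add: cstar_star)
qed

lemma norm_mult_star: "norm (x * star x) = (norm (x::'a::cstar_algebra))\<^sup>2"
  using cstar_norm[of "star x"] by (simp add: cstar_star norm_star)

lemma bounded_linear_star: "bounded_linear (star :: 'a::cstar_algebra \<Rightarrow> 'a)"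
  by (rule bounded_linear_intro[where K = 1])
    (simp_all add: cstar_add star_scaleR norm_star)

section \<open>Closed ideals\<close>

lemma closed_star_idealD:
  assumes "closed_star_ideal J"
  shows closed_star_ideal_closed: "closed J"
    and closed_star_ideal_zero: "0 \<in> J"
    and closed_star_ideal_add: "x \<in> J \<Longrightarrow> y \<in> J \<Longrightarrow> x + y \<in> J"
    and closed_star_ideal_scaleC: "x \<in> J \<Longrightarrow> c *\<^sub>C x \<in> J"
    and closed_star_ideal_mult_left: "x \<in> J \<Longrightarrow> a * x \<in> J"
    and closed_star_ideal_mult_right: "x \<in> J \<Longrightarrow> x * a \<in> J"
    and closed_star_ideal_star: "x \<in> J \<Longrightarrow> star x \<in> J"
  using assms by (auto simp: closed_star_ideal_def)

lemma closed_star_ideal_scaleR: "closed_star_ideal J \<Longrightarrow> x \<in> J \<Longrightarrow> r *\<^sub>R x \<in> J"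
  by (simp add: scaleR_scaleC closed_star_ideal_scaleC)

lemma closed_star_ideal_diff:
  assumes "closed_star_ideal J" "x \<in> J" "y \<in> J" shows "x - y \<in> J"
  using closed_star_ideal_add[OF assms(1,2) closed_star_ideal_scaleC[OF assms(1,3), of "- 1"]]
  by (simp add: scaleC_minus_one)

text \<open>With \<open>a\<^sub>\<plusminus> w = w \<plusminus> i w h\<close> one has \<open>\<parallel>a\<^sub>+ w\<parallel> = \<parallel>a\<^sub>- w\<parallel>\<close>, because \<open>(a\<^sub>\<plusminus> w) (a\<^sub>\<plusminus> w)\<^sup>*\<close> does not
  depend on the sign, and \<open>a\<^sub>+ (a\<^sub>- z) = z + z h h\<close>. The triangle inequality does the rest.\<close>

lemma one_plus_square_bounds:
  fixes h z :: "'a::cstar_algebra"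
  assumes h: "star h = h"
  shows norm_le_one_plus_square: "norm z \<le> norm (z + z * h * h)"
    and norm_mult_le_one_plus_square: "norm (z * h) \<le> norm (z + z * h * h)"
proof -
  define a where "a w = w + \<i> *\<^sub>C (w * h)" for w
  define b where "b w = w - \<i> *\<^sub>C (w * h)" for w
  have sa: "star (a w) = star w - \<i> *\<^sub>C (h * star w)" for w
    by (simp add: a_def cstar_add cstar_scaleC cstar_mult h scaleC_minus_left)
  have sb: "star (b w) = star w + \<i> *\<^sub>C (h * star w)" for w
    by (simp add: b_def star_diff cstar_scaleC cstar_mult h scaleC_minus_left)
  have "a w * star (a w) = b w * star (b w)" for w
    unfolding sa sb unfolding a_def b_def
    by (simp add: algebra_simps mult_scaleC_left mult_scaleC_right scaleC_scaleC
        scaleC_add_right scaleC_diff_right)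
  then have ab: "norm (a w) = norm (b w)" for w
    by (metis norm_mult_star norm_ge_zero power2_eq_iff_nonneg)
  have w: "norm w \<le> norm (a w)" for w
  proof -
    have "2 *\<^sub>R w = a w + b w" by (simp add: a_def b_def scaleR_2)
    then have "2 * norm w \<le> norm (a w) + norm (b w)"
      by (metis norm_scaleR norm_triangle_ineq abs_numeral)
    then show ?thesis by (simp add: ab)
  qed
  have wh: "norm (w * h) \<le> norm (a w)" for w
  proof -
    have "2 *\<^sub>R (\<i> *\<^sub>C (w * h)) = a w - b w" by (simp add: a_def b_def scaleR_2)
    then have "norm (2 *\<^sub>R (\<i> *\<^sub>C (w * h))) \<le> norm (a w) + norm (b w)"
      by (metis norm_triangle_ineq4)
    then show ?thesis by (simp add: ab norm_scaleC)
  qed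
  have "a (b z) = z + z * h * h"
    unfolding a_def b_def
    by (simp add: algebra_simps mult_scaleC_left mult_scaleC_right scaleC_scaleC
        scaleC_add_right scaleC_diff_right scaleC_minus_one)
  then have "norm (b z) \<le> norm (z + z * h * h)" using w[of "b z"] by simp
  then show "norm z \<le> norm (z + z * h * h)" "norm (z * h) \<le> norm (z + z * h * h)"
    using w[of z] wh[of z] by (simp_all add: ab)
qed

lemma one_plus_square_inj:
  fixes h z z' :: "'a::cstar_algebra"
  assumes "star h = h" and "z + z * h * h = z' + z' * h * h"
  shows "z = z'"
  using norm_le_one_plus_square[OF assms(1), of "z - z'"] assms(2)
  by (simp add: algebra_simps)

text \<open>Continuity method: the a priori bound above makes each step from \<open>1 + n d h\<^sup>2\<close> to
  \<open>1 + (n + 1) d h\<^sup>2\<close> a contraction problem, uniformly in \<open>n\<close>.\<close>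

lemma one_plus_square_surj:
  fixes h y :: "'a::cstar_algebra"
  assumes h: "star h = h"
  obtains z where "z + z * h * h = y"
proof -
  \<comment> \<open>\<open>N\<close> steps of length \<open>d = 1 / N\<close> lead from parameter 0
    to 1, and \<open>N > (norm h)\<^sup>2\<close> makes \<open>d * (norm h)\<^sup>2\<close> a
    contraction constant.\<close>
  obtain N :: nat where N: "(norm h)\<^sup>2 < real N" using reals_Archimedean2 by blast
  then have N0: "real N > 0" by (meson le_less_trans zero_le_power2)
  define d where "d = 1 / real N"
  have d0: "d \<ge> 0" by (simp add: d_def)
  have d1: "d * (norm h)\<^sup>2 < 1" using N N0 by (simp add: d_def field_simps)
  have low: "norm z \<le> norm (z + (real n * d) *\<^sub>R (z * h * h))" for n z
  proof -
    \<comment> \<open>Absorbing the factor into the self-adjoint element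
      \<open>r *\<^sub>R h\<close> makes the bound independent of \<open>n\<close>.\<close>
    define r where "r = sqrt (real n * d)"
    have "r * r = real n * d" using d0 by (simp add: r_def)
    then show ?thesis
      using norm_le_one_plus_square[of "r *\<^sub>R h" z] by (simp add: star_scaleR h)
  qed
  have "\<forall>y. \<exists>z. z + (real n * d) *\<^sub>R (z * h * h) = y" for n
  proof (induction n)
    case (Suc n)
    \<comment> \<open>\<open>R\<close> inverts the map of stage \<open>n\<close>; by
      \<open>low\<close> it does not increase distances.\<close>
    define R where "R y = (SOME z. z + (real n * d) *\<^sub>R (z * h * h) = y)" for y
    have R: "R y + (real n * d) *\<^sub>R (R y * h * h) = y" for y
      unfolding R_def by (rule someI_ex) (use Suc in blast)
    have Rd: "norm (R u - R v) \<le> norm (u - v)" for u v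
    proof -
      have "u - v = (R u - R v) + (real n * d) *\<^sub>R ((R u - R v) * h * h)"
        using R[of u] R[of v] by (simp add: algebra_simps)
      then show ?thesis using low[of "R u - R v" n] by simp
    qed
    show ?case
    proof
      fix y
      \<comment> \<open>Applying the map of stage \<open>n\<close> to both sides shows that a fixed
        point solves the equation of stage \<open>n + 1\<close>.\<close>
      have "\<exists>!z\<in>UNIV. R (y - d *\<^sub>R (z * h * h)) = z"
      proof (rule Banach_fix[where c = "d * (norm h)\<^sup>2"])
        fix u v :: 'a
        have "norm ((v - u) * h * h) \<le> norm (v - u) * norm h * norm h"
          by (meson norm_mult_ineq norm_ge_zero mult_right_mono order_trans)
        then have "d * norm ((v - u) * h * h) \<le> d * (norm h)\<^sup>2 * norm (v - u)"
          using mult_left_mono[OF _ d0] by (fastforce simp: power2_eq_square mult_ac)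
        moreover have "norm (R (y - d *\<^sub>R (u * h * h)) - R (y - d *\<^sub>R (v * h * h)))
            \<le> norm (d *\<^sub>R ((v - u) * h * h))"
          using Rd[of "y - d *\<^sub>R (u * h * h)" "y - d *\<^sub>R (v * h * h)"]
          by (simp add: algebra_simps)
        ultimately show "dist (R (y - d *\<^sub>R (u * h * h))) (R (y - d *\<^sub>R (v * h * h)))
            \<le> d * (norm h)\<^sup>2 * dist u v"
          using d0 by (simp add: dist_norm norm_minus_commute)
      qed (use d0 d1 in \<open>auto simp: complete_UNIV\<close>)
      then obtain z where z: "R (y - d *\<^sub>R (z * h * h)) = z" by blast
      have "z + (real (Suc n) * d) *\<^sub>R (z * h * h) = y"
        using R[of "y - d *\<^sub>R (z * h * h)"] unfolding z by (simp add: algebra_simps)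
      then show "\<exists>z. z + (real (Suc n) * d) *\<^sub>R (z * h * h) = y" by blast
    qed
  qed simp
  then obtain z where "z + (real N * d) *\<^sub>R (z * h * h) = y" by blast
  then show thesis using N0 that by (simp add: d_def)
qed

text \<open>The approximants of \<open>y\<close> are \<open>y - z\<close> with \<open>z = y (1 + t\<^sup>2 h\<^sup>2)\<^sup>-\<^sup>1\<close> and \<open>h = y\<^sup>* y\<close>; they lie in
  \<open>K\<close> since \<open>h\<close> does, and \<open>\<parallel>z\<parallel>\<^sup>4 \<le> \<parallel>h\<parallel> / t\<close>.\<close>

lemma closed_star_ideal_star_mult_self:
  fixes y :: "'a::cstar_algebra"
  assumes K: "closed_star_ideal K" and yK: "star y * y \<in> K"
  shows "y \<in> K"
proof -
  define h where "h = star y * y"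
  have h: "star h = h" by (simp add: h_def cstar_mult cstar_star)
  have "\<exists>x\<in>K. dist x y < e" if e: "e > 0" for e
  proof -
    \<comment> \<open>Chosen so that \<open>norm h < t * e ^ 4\<close>, which turns the bound on
      \<open>norm z ^ 4\<close> into \<open>norm z < e\<close>.\<close>
    define t where "t = (norm h + 1) / e ^ 4"
    have t: "t > 0" using e by (simp add: t_def add_nonneg_pos)
    define k where "k = t *\<^sub>R h"
    have k: "star k = k" by (simp add: k_def star_scaleR h)
    obtain z where z: "z + z * k * k = y" using one_plus_square_surj[OF k] .
    \<comment> \<open>Formally \<open>g = h (1 + k\<^sup>2)\<^sup>-\<^sup>1\<close>.\<close>
    define g where "g = star y * z"
    have g: "g + g * k * k = h"
      by (simp add: g_def h_def flip: z distrib_left mult.assoc) (simp add: algebra_simps)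
    \<comment> \<open>\<open>h * g\<close> and \<open>g * h\<close> both solve
      \<open>w + w * k * k = h * h\<close>, because \<open>k\<close> is a multiple of
      \<open>h\<close>.\<close>
    have "h * g + (h * g) * k * k = h * (g + g * k * k)"
      by (simp only: distrib_left mult.assoc)
    also have "\<dots> = (g + g * k * k) * h"
      by (simp only: g)
    also have "\<dots> = g * h + (g * h) * k * k"
      by (simp add: distrib_right mult.assoc k_def)
    finally have hg: "h * g = g * h"
      by (rule one_plus_square_inj[OF k])
    \<comment> \<open>The estimates chain to \<open>norm z ^ 4 \<le> (norm g)\<^sup>2 \<le> norm (g
      * h) \<le> norm h / t\<close>.\<close>
    have "(norm z)\<^sup>2 = norm (star z * z)" by (simp add: cstar_norm)
    also have "\<dots> \<le> norm (star z * z + star z * z * k * k)"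
      by (rule norm_le_one_plus_square[OF k])
    also have "star z * z + star z * z * k * k = star z * (z + z * k * k)"
      by (simp add: algebra_simps)
    also have "\<dots> = star g" by (simp add: z g_def cstar_mult cstar_star)
    finally have zg: "(norm z)\<^sup>2 \<le> norm g" by (simp add: norm_star)
    have "(norm g)\<^sup>2 = norm (star g * g)" by (simp add: cstar_norm)
    also have "\<dots> \<le> norm (star g * g + star g * g * k * k)"
      by (rule norm_le_one_plus_square[OF k])
    also have "star g * g + star g * g * k * k = star g * (g + g * k * k)"
      by (simp add: algebra_simps)
    also have "\<dots> = star (h * g)" by (simp add: g cstar_mult h)
    finally have gg: "(norm g)\<^sup>2 \<le> norm (g * h)" by (simp add: norm_star hg)
    have "t * norm (g * h) \<le> norm h"
      using norm_mult_le_one_plus_square[OF k, of g] t unfolding g by (simp add: k_def)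
    then have "t * (norm g)\<^sup>2 \<le> norm h"
      using mult_left_mono[OF gg, of t] t by linarith
    moreover have "(norm z) ^ 4 \<le> (norm g)\<^sup>2"
      using power_mono[OF zg, of 2] by simp
    ultimately have "t * (norm z) ^ 4 \<le> norm h"
      using t by (meson mult_left_mono order_trans less_imp_le)
    also have "\<dots> < t * e ^ 4" using e by (simp add: t_def)
    finally have "(norm z) ^ 4 < e ^ 4" using t by simp
    then have "norm z < e" using e by (simp add: power_less_imp_less_base)
    moreover have "y - z \<in> K"
    proof -
      have "y - z = z * k * k" using z by (simp add: algebra_simps)
      moreover have "k \<in> K" using K yK by (simp add: k_def h_def closed_star_ideal_scaleR)
      ultimately show ?thesis using K by (simp add: closed_star_ideal_mult_left)
    qed
    ultimately show ?thesis by (intro bexI[of _ "y - z"]) (auto simp: dist_norm)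
  qed
  then have "y \<in> closure K" by (simp add: closure_approachable)
  then show ?thesis using closed_star_ideal_closed[OF K] by simp
qed

lemma star_hom_onD:
  assumes "star_hom_on J f"
  shows star_hom_on_add: "x \<in> J \<Longrightarrow> y \<in> J \<Longrightarrow> f (x + y) = f x + f y"
    and star_hom_on_scaleC: "x \<in> J \<Longrightarrow> f (c *\<^sub>C x) = c *\<^sub>C f x"
    and star_hom_on_mult: "x \<in> J \<Longrightarrow> y \<in> J \<Longrightarrow> f (x * y) = f x * f y"
    and star_hom_on_star: "x \<in> J \<Longrightarrow> f (star x) = star (f x)"
  using assms by (auto simp: star_hom_on_def)

lemma star_hom_on_scaleR: "star_hom_on J f \<Longrightarrow> x \<in> J \<Longrightarrow> f (r *\<^sub>R x) = r *\<^sub>R f x"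
  by (simp add: scaleR_scaleC star_hom_on_scaleC)

lemma star_hom_on_diff:
  assumes J: "closed_star_ideal J" and f: "star_hom_on J f" and "x \<in> J" "y \<in> J"
  shows "f (x - y) = f x - f y"
  using star_hom_on_add[OF f, of "x - y" y] closed_star_ideal_diff[OF J] assms(3,4)
  by (simp add: algebra_simps)

text \<open>The equation says \<open>1 - h\<^sup>2 = (1 - a)\<^sup>2\<close>.\<close>

lemma sqrt_one_minus_square:
  fixes h :: "'a::cstar_algebra"
  assumes J: "closed_star_ideal J" and hJ: "h \<in> J" and h: "star h = h" and h1: "norm h < 1"
  obtains a where "a \<in> J" "star a = a" "a * h = h * a" "2 *\<^sub>R a = h * h + a * a"
proof -
  \<comment> \<open>The required properties of \<open>a\<close> are closed conditions preserved by
    \<open>T\<close>, so the fixed point inherits them. On the ball of radius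
    \<open>norm h < 1\<close> the map \<open>T\<close> has Lipschitz constant
    \<open>norm h\<close>.\<close>
  define S where "S = J \<inter> {a. star a = a} \<inter> {a. a * h = h * a} \<inter> cball 0 (norm h)"
  define T where "T a = (1/2) *\<^sub>R (h * h + a * a)" for a
  have "\<exists>!a\<in>S. T a = a"
  proof (rule Banach_fix[where c = "norm h"])
    have "closed {a::'a. star a = a}"
      by (intro closed_Collect_eq linear_continuous_on bounded_linear_star continuous_on_id)
    moreover have "closed {a. a * h = h * a}"
      by (intro closed_Collect_eq continuous_intros)
    ultimately have "closed S" using closed_star_ideal_closed[OF J] unfolding S_def
      by (intro closed_Int closed_cball)
    then show "complete S" by (simp add: complete_eq_closed)
    show "S \<noteq> {}" using closed_star_ideal_zero[OF J] by (auto simp: S_def)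
    show "T ` S \<subseteq> S"
    proof
      fix b assume "b \<in> T ` S"
      then obtain a where a: "a \<in> J" "star a = a" "a * h = h * a" "norm a \<le> norm h" and b: "b = T a"
        by (auto simp: S_def)
      have "norm (h * h + a * a) \<le> norm h * norm h + norm a * norm a"
        by (meson norm_add_leD norm_mult_ineq order_trans add_mono norm_triangle_ineq)
      also have "\<dots> \<le> 1 * norm h + 1 * norm h"
        using a(4) h1 by (intro add_mono mult_mono) auto
      finally have "norm b \<le> norm h" by (simp add: b T_def)
      moreover have "b \<in> J"
        unfolding b T_def using a hJ
        by (intro closed_star_ideal_scaleR[OF J] closed_star_ideal_add[OF J]
            closed_star_ideal_mult_left[OF J])
      moreover have "star b = b" by (simp add: b T_def star_scaleR cstar_add cstar_mult h a)
      moreover have "b * h = h * b"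
        unfolding b T_def using a(3) by (simp add: algebra_simps) (metis mult.assoc)
      ultimately show "b \<in> S" by (simp add: S_def)
    qed
    fix a b assume a: "a \<in> S" and b: "b \<in> S"
    have ab: "norm a \<le> norm h" "norm b \<le> norm h" using a b by (auto simp: S_def)
    have "norm (a * a - b * b) = norm (a * (a - b) + (a - b) * b)" by (simp add: algebra_simps)
    also have "\<dots> \<le> norm a * norm (a - b) + norm (a - b) * norm b"
      by (meson norm_mult_ineq order_trans add_mono norm_triangle_ineq)
    also have "\<dots> \<le> norm h * norm (a - b) + norm (a - b) * norm h"
      using ab by (intro add_mono mult_mono) auto
    finally show "dist (T a) (T b) \<le> norm h * dist a b"
      by (simp add: T_def dist_norm flip: scaleR_diff_right)
  qed (use h1 in auto)
  then obtain a where "a \<in> S" and a: "T a = a" by blast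
  moreover have "2 *\<^sub>R a = h * h + a * a" using arg_cong[OF a, of "\<lambda>x. 2 *\<^sub>R x"] by (simp add: T_def)
  ultimately show thesis using that by (auto simp: S_def)
qed

text \<open>For self-adjoint \<open>h\<close> with \<open>\<parallel>h\<parallel> < 1\<close> and \<open>1 - h\<^sup>2 = (1 - a)\<^sup>2\<close>, the operator
  \<open>f h + i (1 - f a)\<close> is unitary, so its real part \<open>f h\<close> has norm at most \<open>1\<close>.\<close>

lemma norm_star_hom_on_self_adjoint:
  fixes h :: "'a::cstar_algebra"
  assumes J: "closed_star_ideal J" and f: "star_hom_on J f"
    and hJ: "h \<in> J" and h: "star h = h" and h1: "norm h < 1"
  shows "norm (f h) \<le> 1"
proof -
  obtain a where a: "a \<in> J" "star a = a" "a * h = h * a" "2 *\<^sub>R a = h * h + a * a"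
    using sqrt_one_minus_square[OF J hJ h h1] .
  define k where "k = f h"
  define b where "b = f a"
  have k: "star k = k" unfolding k_def using star_hom_on_star[OF f hJ] h by simp
  have b: "star b = b" unfolding b_def using star_hom_on_star[OF f a(1)] a(2) by simp
  have bk: "b * k = k * b"
    using a hJ by (simp add: b_def k_def flip: star_hom_on_mult[OF f])
  have 2: "2 *\<^sub>R b = k * k + b * b"
    unfolding b_def k_def using a hJ
    by (simp add: closed_star_ideal_mult_left[OF J]
        flip: star_hom_on_mult[OF f] star_hom_on_scaleR[OF f] star_hom_on_add[OF f])
  have "(norm k)\<^sup>2 \<le> norm k"
  proof -
    \<comment> \<open>\<open>u\<close> is \<open>k\<close> times the formal unitary
      \<open>k + i (1 - b)\<close>. The extra factor keeps the computation inside the algebra, which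
      may lack a unit.\<close>
    define u where "u = k * k + \<i> *\<^sub>C (k - b * k)"
    define v where "v = k * k - \<i> *\<^sub>C (k - b * k)"
    have kb: "b * (k * x) = k * (b * x)" for x by (metis bk mult.assoc)
    have kkbb: "k * (b * b) = 2 *\<^sub>R (k * b) - k * (k * k)"
      by (metis "2" add_diff_cancel_left' distrib_left mult_scaleR_right)
    have kkkbb: "k * (k * (b * b)) = 2 *\<^sub>R (k * (k * b)) - k * (k * (k * k))"
      by (metis kkbb mult_scaleR_right right_diff_distrib)
    have su: "star u = v"
      by (simp add: u_def v_def k b bk cstar_add star_diff cstar_scaleC cstar_mult scaleC_minus_left)
    have sv: "star v = u"
      by (metis cstar_star su)
    have uv: "u * v = k * k" "v * u = k * k"
      unfolding u_def v_def
      by (simp_all add: algebra_simps mult_scaleC_left mult_scaleC_right scaleC_scaleC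
        scaleC_add_right scaleC_diff_right scaleC_minus_one bk kb kkbb kkkbb scaleR_2)
    have "(norm u)\<^sup>2 = (norm k)\<^sup>2" "(norm v)\<^sup>2 = (norm k)\<^sup>2"
      using cstar_norm[of u] cstar_norm[of v] cstar_norm[of k] by (simp_all add: su sv uv k)
    then have n: "norm u = norm k" "norm v = norm k" by simp_all
    have "2 *\<^sub>R (k * k) = u + v" by (simp add: u_def v_def scaleR_2)
    then have "norm (2 *\<^sub>R (k * k)) \<le> 2 * norm k"
      using norm_triangle_ineq[of u v] by (simp add: n)
    then show ?thesis using cstar_norm[of k] by (simp add: k)
  qed
  then show ?thesis unfolding k_def[symmetric]
    by (metis mult_le_cancel_left2 norm_ge_zero power2_eq_square not_less le_less zero_le_one)
qed

text \<open>The C*-identity reduces the claim to \<open>star x * x\<close>. Dividing that element by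
  any \<open>r\<close> above its norm meets the strict bound of the self-adjoint case; then
  \<open>r\<close> decreases to the norm.\<close>

lemma norm_star_hom_on_le:
  fixes x :: "'a::cstar_algebra"
  assumes J: "closed_star_ideal J" and f: "star_hom_on J f" and x: "x \<in> J"
  shows "norm (f x) \<le> norm x"
proof -
  define h where "h = star x * x"
  have hJ: "h \<in> J" using J x by (simp add: h_def closed_star_ideal_mult_left)
  have h: "star h = h" by (simp add: h_def cstar_mult cstar_star)
  have "norm (f h) \<le> r" if r: "r > norm h" for r
  proof -
    have r0: "r > 0" using r by (meson le_less_trans norm_ge_zero)
    have "norm (f ((1 / r) *\<^sub>R h)) \<le> 1"
      by (rule norm_star_hom_on_self_adjoint[OF J f closed_star_ideal_scaleR[OF J hJ]])
        (use r r0 in \<open>simp_all add: star_scaleR h field_simps\<close>)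
    then show ?thesis using r0 by (simp add: star_hom_on_scaleR[OF f hJ] field_simps)
  qed
  then have "norm (f h) \<le> norm h" by (rule dense_ge)
  moreover have "f h = star (f x) * f x"
    using x by (simp add: h_def star_hom_on_mult[OF f] star_hom_on_star[OF f] closed_star_ideal_star[OF J])
  ultimately have "(norm (f x))\<^sup>2 \<le> (norm x)\<^sup>2" by (simp add: cstar_norm h_def)
  then show ?thesis by (rule power2_le_imp_le) simp
qed

text \<open>That the preimage absorbs products with all of the algebra, and not just with \<open>J\<close>, comes
  from \<open>(f (a x))\<^sup>* f (a x) = (f x)\<^sup>* f (a\<^sup>* a x)\<close>.\<close>

lemma closed_star_ideal_preimage:
  fixes f :: "'a::cstar_algebra \<Rightarrow> 'a"
  assumes J: "closed_star_ideal J" and K: "closed_star_ideal K" and f: "star_hom_on J f"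
  shows "closed_star_ideal {x \<in> J. f x \<in> K}"
proof -
  define I where "I = {x \<in> J. f x \<in> K}"
  note Js = closed_star_idealD[OF J] and Ks = closed_star_idealD[OF K]
  have f0: "f 0 = 0"
    using norm_star_hom_on_le[OF J f, of 0] Js(2) by simp
  have "continuous_on J f"
  proof (rule continuous_onI)
    fix x e :: real and y assume "y \<in> J" "(e::real) > 0"
    then show "\<exists>d>0. \<forall>y'\<in>J. dist y' y < d \<longrightarrow> dist (f y') (f y) \<le> e"
      using norm_star_hom_on_le[OF J f] star_hom_on_diff[OF J f] closed_star_ideal_diff[OF J]
      by (metis dist_norm less_imp_le order_trans)
  qed
  then have "closed (J \<inter> f -` K)" using Js(1) Ks(1) by (intro continuous_closed_preimage)
  moreover have "J \<inter> f -` K = I" by (auto simp: I_def)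
  ultimately have cl: "closed I" by simp
  have st: "star x \<in> I" if "x \<in> I" for x
    using that by (auto simp: I_def Js Ks star_hom_on_star[OF f])
  have ml: "a * x \<in> I" if x: "x \<in> I" for a x
  proof -
    have xJ: "x \<in> J" and xK: "f x \<in> K" using x by (auto simp: I_def)
    have "star (f (a * x)) * f (a * x) = f (star x * (star a * (a * x)))"
      using xJ by (simp add: Js cstar_mult mult.assoc flip: star_hom_on_mult[OF f] star_hom_on_star[OF f])
    also have "\<dots> = star (f x) * f (star a * (a * x))"
      using xJ by (simp add: Js star_hom_on_mult[OF f] star_hom_on_star[OF f])
    finally have "star (f (a * x)) * f (a * x) \<in> K" using xK by (simp add: Ks)
    then have "f (a * x) \<in> K" by (rule closed_star_ideal_star_mult_self[OF K])
    then show ?thesis using xJ by (simp add: I_def Js)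
  qed
  have mr: "x * a \<in> I" if "x \<in> I" for a x
    using st[OF ml[OF st[OF that], of "star a"]] by (simp add: cstar_mult cstar_star)
  show ?thesis
    unfolding I_def[symmetric] closed_star_ideal_def using cl st ml mr
    by (auto simp: I_def f0 Js Ks star_hom_on_add[OF f] star_hom_on_scaleC[OF f])
qed


section \<open>Partial automorphisms\<close>

text \<open>For a partial injection the graph of the inverse is the converse graph. This replaces
  the definite description in the identities below, which become statements about relations.\<close>

lemma partial_inverse_eq_Some_iff:
  assumes "inj_on \<phi> (dom \<phi>)"
  shows "partial_inverse \<phi> y = Some x \<longleftrightarrow> \<phi> x = Some y"
proof -
  have u: "x' = x" if "\<phi> x = Some y" "\<phi> x' = Some y" for x x' y
    using that assms by (metis domI inj_onD)
  show ?thesis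
  proof
    assume "partial_inverse \<phi> y = Some x"
    then have "y \<in> ran \<phi>" "x = (THE x. \<phi> x = Some y)"
      by (auto simp: partial_inverse_def split: if_splits)
    then show "\<phi> x = Some y" using u by (auto simp: ran_def intro: theI2)
  next
    assume "\<phi> x = Some y"
    then show "partial_inverse \<phi> y = Some x"
      using u by (auto simp: partial_inverse_def ran_def)
  qed
qed

lemma option_map_eqI:
  assumes "\<And>x y. \<phi> x = Some y \<longleftrightarrow> \<psi> x = Some y"
  shows "\<phi> = \<psi>"
  using assms by (metis ext option.exhaust)

context
  fixes \<phi> :: "'a \<rightharpoonup> 'a"
  assumes inj: "inj_on \<phi> (dom \<phi>)"
begin

lemma dom_partial_inverse: "dom (partial_inverse \<phi>) = ran \<phi>"
  by (auto simp: dom_def ran_def partial_inverse_eq_Some_iff[OF inj])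

lemma ran_partial_inverse: "ran (partial_inverse \<phi>) = dom \<phi>"
  by (auto simp: dom_def ran_def partial_inverse_eq_Some_iff[OF inj])

lemma inj_on_partial_inverse: "inj_on (partial_inverse \<phi>) (dom (partial_inverse \<phi>))"
proof (rule inj_onI)
  fix x y assume "x \<in> dom (partial_inverse \<phi>)" "partial_inverse \<phi> x = partial_inverse \<phi> y"
  then show "x = y" by (metis domD option.inject partial_inverse_eq_Some_iff[OF inj])
qed

lemma partial_inverse_partial_inverse: "partial_inverse (partial_inverse \<phi>) = \<phi>"
  by (rule option_map_eqI)
    (simp add: partial_inverse_eq_Some_iff[OF inj] partial_inverse_eq_Some_iff[OF inj_on_partial_inverse])

lemma map_comp_partial_inverse_map_comp: "(\<phi> \<circ>\<^sub>m partial_inverse \<phi>) \<circ>\<^sub>m \<phi> = \<phi>"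
  by (rule option_map_eqI) (auto simp: map_comp_Some_iff partial_inverse_eq_Some_iff[OF inj])

lemma map_comp_partial_inverse_eq_Some_iff:
  "(\<phi> \<circ>\<^sub>m partial_inverse \<phi>) x = Some y \<longleftrightarrow> y = x \<and> x \<in> ran \<phi>"
  by (auto simp: map_comp_Some_iff partial_inverse_eq_Some_iff[OF inj] ran_def)

lemma inj_on_map_comp:
  assumes "inj_on \<psi> (dom \<psi>)"
  shows "inj_on (\<phi> \<circ>\<^sub>m \<psi>) (dom (\<phi> \<circ>\<^sub>m \<psi>))"
proof (rule inj_onI)
  fix x y assume "x \<in> dom (\<phi> \<circ>\<^sub>m \<psi>)" "(\<phi> \<circ>\<^sub>m \<psi>) x = (\<phi> \<circ>\<^sub>m \<psi>) y"
  then obtain z where z: "(\<phi> \<circ>\<^sub>m \<psi>) x = Some z" "(\<phi> \<circ>\<^sub>m \<psi>) y = Some z" by (metis domD)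
  then obtain u v where "\<psi> x = Some u" "\<phi> u = Some z" "\<psi> y = Some v" "\<phi> v = Some z"
    by (auto simp: map_comp_Some_iff)
  then show "x = y" using inj assms by (metis domI inj_onD)
qed

lemma partial_inverse_map_comp:
  assumes "inj_on \<psi> (dom \<psi>)"
  shows "partial_inverse (\<phi> \<circ>\<^sub>m \<psi>) = partial_inverse \<psi> \<circ>\<^sub>m partial_inverse \<phi>"
  by (rule option_map_eqI)
    (auto simp: map_comp_Some_iff partial_inverse_eq_Some_iff[OF inj]
      partial_inverse_eq_Some_iff[OF assms] partial_inverse_eq_Some_iff[OF inj_on_map_comp[OF assms]])

end

text \<open>Both sides are the identity restricted to the intersection of the two ranges.\<close>

lemma map_comp_partial_inverse_commute:
  assumes "inj_on \<phi> (dom \<phi>)" "inj_on \<psi> (dom \<psi>)"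
  shows "(\<phi> \<circ>\<^sub>m partial_inverse \<phi>) \<circ>\<^sub>m (\<psi> \<circ>\<^sub>m partial_inverse \<psi>) =
         (\<psi> \<circ>\<^sub>m partial_inverse \<psi>) \<circ>\<^sub>m (\<phi> \<circ>\<^sub>m partial_inverse \<phi>)"
  by (rule option_map_eqI)
    (auto simp: map_comp_Some_iff[of "_ \<circ>\<^sub>m _"] map_comp_partial_inverse_eq_Some_iff assms)

lemma map_comp_assoc: "(\<phi> \<circ>\<^sub>m \<psi>) \<circ>\<^sub>m \<rho> = \<phi> \<circ>\<^sub>m (\<psi> \<circ>\<^sub>m \<rho>)"
  by (rule option_map_eqI) (auto simp: map_comp_Some_iff)

section \<open>Inversion and composition of partial automorphisms\<close>

lemma partial_automorphismD:
  assumes "partial_automorphism \<phi>"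
  shows partial_automorphism_dom: "closed_star_ideal (dom \<phi>)"
    and partial_automorphism_ran: "closed_star_ideal (ran \<phi>)"
    and partial_automorphism_inj: "inj_on \<phi> (dom \<phi>)"
    and partial_automorphism_hom: "star_hom_on (dom \<phi>) (\<lambda>x. the (\<phi> x))"
  using assms by (auto simp: partial_automorphism_def)

lemma partial_automorphism_partial_inverse:
  assumes "partial_automorphism \<phi>"
  shows "partial_automorphism (partial_inverse \<phi>)"
proof -
  note \<phi> = partial_automorphismD[OF assms]
  define g where "g y = the (partial_inverse \<phi> y)" for y
  have g: "\<phi> (g y) = Some y" if "y \<in> ran \<phi>" for y
    using that unfolding g_def
    by (metis dom_partial_inverse[OF \<phi>(3)] domD option.sel partial_inverse_eq_Some_iff[OF \<phi>(3)])
  \<comment> \<open>To identify \<open>g y\<close> it suffices to exhibit a preimage of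
    \<open>y\<close>, so each homomorphism law for \<open>g\<close> reduces to the same law for
    \<open>\<phi>\<close>.\<close>
  have gI: "g y = x" if "x \<in> dom \<phi>" "the (\<phi> x) = y" for x y
    using that unfolding g_def
    by (metis domD option.sel partial_inverse_eq_Some_iff[OF \<phi>(3)])
  have gd: "g y \<in> dom \<phi>" "the (\<phi> (g y)) = y" if "y \<in> ran \<phi>" for y
    using g[OF that] by auto
  have "star_hom_on (ran \<phi>) g"
    unfolding star_hom_on_def
    by (intro conjI allI ballI gI)
      (simp_all add: gd closed_star_idealD[OF \<phi>(1)] star_hom_onD[OF \<phi>(4)])
  then show ?thesis
    using \<phi> inj_on_partial_inverse[OF \<phi>(3)]
    by (simp add: partial_automorphism_def dom_partial_inverse ran_partial_inverse g_def[abs_def])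
qed

text \<open>The domain is the preimage under \<open>\<psi>\<close> of the ideal
  \<open>dom \<phi>\<close>; here the analytic result enters.\<close>

lemma closed_star_ideal_dom_map_comp:
  assumes "partial_automorphism \<phi>" "partial_automorphism \<psi>"
  shows "closed_star_ideal (dom (\<phi> \<circ>\<^sub>m \<psi>))"
proof -
  have "dom (\<phi> \<circ>\<^sub>m \<psi>) = {x \<in> dom \<psi>. the (\<psi> x) \<in> dom \<phi>}"
    by (auto simp: dom_def map_comp_Some_iff)
  then show ?thesis
    using closed_star_ideal_preimage[OF partial_automorphism_dom[OF assms(2)]
        partial_automorphism_dom[OF assms(1)] partial_automorphism_hom[OF assms(2)]]
    by simp
qed

lemma partial_automorphism_map_comp:
  assumes "partial_automorphism \<phi>" "partial_automorphism \<psi>"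
  shows "partial_automorphism (\<phi> \<circ>\<^sub>m \<psi>)"
proof -
  note \<phi> = partial_automorphismD[OF assms(1)] and \<psi> = partial_automorphismD[OF assms(2)]
  have inj: "inj_on (\<phi> \<circ>\<^sub>m \<psi>) (dom (\<phi> \<circ>\<^sub>m \<psi>))" using \<phi>(3) \<psi>(3) by (rule inj_on_map_comp)
  \<comment> \<open>The range is the domain of the inverse, which is again a composite of partial
    automorphisms, so the result on domains covers it.\<close>
  have "closed_star_ideal (dom (partial_inverse (\<phi> \<circ>\<^sub>m \<psi>)))"
    unfolding partial_inverse_map_comp[OF \<phi>(3) \<psi>(3)]
    by (intro closed_star_ideal_dom_map_comp partial_automorphism_partial_inverse assms)
  then have ran: "closed_star_ideal (ran (\<phi> \<circ>\<^sub>m \<psi>))"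
    by (simp add: dom_partial_inverse[OF inj])
  have d: "x \<in> dom \<psi>" "the (\<psi> x) \<in> dom \<phi>" "the ((\<phi> \<circ>\<^sub>m \<psi>) x) = the (\<phi> (the (\<psi> x)))"
    if "x \<in> dom (\<phi> \<circ>\<^sub>m \<psi>)" for x
    using that by (auto simp: dom_def map_comp_Some_iff)
  note dc = closed_star_ideal_dom_map_comp[OF assms]
  have "star_hom_on (dom (\<phi> \<circ>\<^sub>m \<psi>)) (\<lambda>x. the ((\<phi> \<circ>\<^sub>m \<psi>) x))"
    unfolding star_hom_on_def
    by (intro conjI allI ballI)
      (simp_all add: d closed_star_idealD[OF dc] star_hom_onD[OF \<phi>(4)] star_hom_onD[OF \<psi>(4)])
  with dc ran inj show ?thesis by (simp add: partial_automorphism_def)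
qed

lemma partial_automorphism_total:
  assumes "star_hom_on UNIV f" "inj f" "closed_star_ideal (range f)"
  shows "partial_automorphism (\<lambda>x. Some (f x))"
proof -
  have "dom (\<lambda>x. Some (f x)) = UNIV" "ran (\<lambda>x. Some (f x)) = range f"
    by (auto simp: ran_def)
  moreover have "closed_star_ideal (UNIV :: 'a set)" by (simp add: closed_star_ideal_def)
  ultimately show ?thesis using assms by (auto simp: partial_automorphism_def inj_on_def)
qed


section \<open>Extending an injective action to the inverse semigroup\<close>

primrec inv_term_action :: "('g \<Rightarrow> 'a \<Rightarrow> 'a) \<Rightarrow> 'g inv_term \<Rightarrow> 'a \<rightharpoonup> 'a" where
  "inv_term_action \<alpha> (Gen p) = (\<lambda>x. Some (\<alpha> p x))"
| "inv_term_action \<alpha> (Mul a b) = inv_term_action \<alpha> a \<circ>\<^sub>m inv_term_action \<alpha> b"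
| "inv_term_action \<alpha> (Star a) = partial_inverse (inv_term_action \<alpha> a)"

text \<open>Evaluation uses a chosen representative. Its independence of the choice is proved only
  for injective \<open>\<alpha> p\<close>, so it is a separate lemma and not a lifting
  obligation.\<close>

definition free_action :: "('g \<Rightarrow> 'a \<Rightarrow> 'a) \<Rightarrow> 'g free_inverse_semigroup \<Rightarrow> 'a \<rightharpoonup> 'a" where
  "free_action \<alpha> x = inv_term_action \<alpha> (rep_free_inverse_semigroup x)"

definition semigroup_star_action ::
  "('s::monoid_mult \<Rightarrow> 'a \<Rightarrow> 'a) \<Rightarrow> 's semigroup_star \<Rightarrow> 'a \<rightharpoonup> 'a" where
  "semigroup_star_action \<alpha> x = free_action \<alpha> (rep_semigroup_star x)"

context
  fixes \<alpha> :: "'g \<Rightarrow> 'a \<Rightarrow> 'a"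
  assumes inj: "\<And>p. inj (\<alpha> p)"
begin

text \<open>This ensures that \<open>partial_inverse\<close> is a genuine inverse at every
  \<open>Star\<close> node.\<close>

lemma inj_on_inv_term_action: "inj_on (inv_term_action \<alpha> t) (dom (inv_term_action \<alpha> t))"
proof (induction t)
  case (Gen p)
  show ?case using inj[of p] by (auto simp: inj_on_def)
qed (auto intro!: inj_on_map_comp inj_on_partial_inverse)

text \<open>Each rule of \<open>inv_eq\<close> is an identity between partial injections.\<close>

lemma inv_term_action_eq: "inv_eq s t \<Longrightarrow> inv_term_action \<alpha> s = inv_term_action \<alpha> t"
  by (induction rule: inv_eq.induct)
    (simp_all only: inv_term_action.simps map_comp_assoc[symmetric]
      partial_inverse_map_comp partial_inverse_partial_inverse map_comp_partial_inverse_map_comp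
      map_comp_partial_inverse_commute inj_on_inv_term_action,
      metis inj_on_inv_term_action map_comp_assoc map_comp_partial_inverse_commute)

lemma free_action_abs: "free_action \<alpha> (abs_free_inverse_semigroup t) = inv_term_action \<alpha> t"
  unfolding free_action_def
  by (metis inv_term_action_eq Quotient_free_inverse_semigroup rep_abs_rsp inv_eq.refl Quotient_rep_abs)

lemma free_action_gen: "free_action \<alpha> (free_gen p) = (\<lambda>x. Some (\<alpha> p x))"
  by (simp add: free_gen.abs_eq free_action_abs)

lemma free_action_mult: "free_action \<alpha> (x * y) = free_action \<alpha> x \<circ>\<^sub>m free_action \<alpha> y"
  by (metis free_action_abs inv_term_action.simps(2) times_free_inverse_semigroup.abs_eq
      Quotient_abs_rep Quotient_free_inverse_semigroup)

lemma free_action_star: "free_action \<alpha> (star x) = partial_inverse (free_action \<alpha> x)"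
  by (metis free_action_abs inv_term_action.simps(3) star_free_inverse_semigroup.abs_eq
      Quotient_abs_rep Quotient_free_inverse_semigroup)

end

section \<open>Descent to the inverse semigroup of isometries\<close>

context
  fixes \<alpha> :: "'s::monoid_mult \<Rightarrow> 'a::cstar_algebra \<Rightarrow> 'a"
  assumes action: "injective_ideal_action \<alpha>"
begin

lemma injective_ideal_actionD:
  shows injective_ideal_action_hom: "star_hom_on UNIV (\<alpha> s)"
    and injective_ideal_action_inj: "inj (\<alpha> s)"
    and injective_ideal_action_range: "closed_star_ideal (range (\<alpha> s))"
    and injective_ideal_action_mult: "\<alpha> (s * t) = \<alpha> s \<circ> \<alpha> t"
  using action by (auto simp: injective_ideal_action_def)

text \<open>An injective idempotent map is the identity.\<close>

lemma injective_ideal_action_one: "\<alpha> 1 = id"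
proof
  fix x
  have "\<alpha> 1 (\<alpha> 1 x) = \<alpha> 1 x" using injective_ideal_action_mult[of 1 1] by (simp add: fun_eq_iff)
  then show "\<alpha> 1 x = id x" using injective_ideal_action_inj[of 1] by (simp add: inj_eq)
qed

lemma free_action_eq: "isometry_cong x y \<Longrightarrow> free_action \<alpha> x = free_action \<alpha> y"
proof (induction rule: isometry_cong.induct)
  case (gen_mult p q)
  show ?case
    by (simp add: free_action_mult free_action_gen injective_ideal_action_inj
        injective_ideal_action_mult map_comp_def)
next
  \<comment> \<open>The partial inverse undoes the total injection \<open>\<alpha> p\<close>
    everywhere, and \<open>free_gen 1\<close> acts by \<open>\<alpha> 1 = id\<close>.\<close>
  case (gen_isometry p)
  have inj: "inj_on (\<lambda>x. Some (\<alpha> p x)) (dom (\<lambda>x. Some (\<alpha> p x)))"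
    using injective_ideal_action_inj[of p] by (auto simp: inj_on_def)
  show ?case
    by (rule option_map_eqI)
      (use injective_ideal_action_inj in \<open>auto simp: free_action_mult free_action_star free_action_gen
        injective_ideal_action_one map_comp_Some_iff partial_inverse_eq_Some_iff[OF inj] inj_eq\<close>)
qed (simp_all add: free_action_mult free_action_star injective_ideal_action_inj)

lemma semigroup_star_action_abs:
  "semigroup_star_action \<alpha> (abs_semigroup_star x) = free_action \<alpha> x"
  unfolding semigroup_star_action_def
  by (metis free_action_eq Quotient_semigroup_star rep_abs_rsp isometry_cong.refl Quotient_rep_abs)

lemma semigroup_star_action_gen: "semigroup_star_action \<alpha> (gen p) = (\<lambda>x. Some (\<alpha> p x))"
  by (simp add: gen.abs_eq semigroup_star_action_abs free_action_gen injective_ideal_action_inj)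

lemma semigroup_star_action_mult:
  "semigroup_star_action \<alpha> (x * y) = semigroup_star_action \<alpha> x \<circ>\<^sub>m semigroup_star_action \<alpha> y"
  by (metis semigroup_star_action_abs free_action_mult injective_ideal_action_inj
      times_semigroup_star.abs_eq Quotient_abs_rep Quotient_semigroup_star)

lemma semigroup_star_action_star:
  "semigroup_star_action \<alpha> (star x) = partial_inverse (semigroup_star_action \<alpha> x)"
  by (metis semigroup_star_action_abs free_action_star injective_ideal_action_inj
      star_semigroup_star.abs_eq Quotient_abs_rep Quotient_semigroup_star)

lemma partial_automorphism_semigroup_star_action:
  "partial_automorphism (semigroup_star_action \<alpha> x)"
proof (induction x rule: semigroup_star_induct)
  case (1 p)
  show ?case unfolding semigroup_star_action_gen
    by (intro partial_automorphism_total injective_ideal_action_hom injective_ideal_action_inj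
        injective_ideal_action_range)
qed (simp_all add: semigroup_star_action_mult semigroup_star_action_star
    partial_automorphism_map_comp partial_automorphism_partial_inverse)

lemma unital_action_semigroup_star_action: "unital_action (semigroup_star_action \<alpha>)"
proof -
  have one: "semigroup_star_action \<alpha> 1 = Some"
    by (simp add: one_semigroup_star_def semigroup_star_action_gen injective_ideal_action_one fun_eq_iff)
  \<comment> \<open>The unit alone already covers the algebra.\<close>
  have "y \<in> ran (semigroup_star_action \<alpha> 1)" for y
    unfolding one by (simp add: ran_def)
  then have "(\<Union>x. ran (semigroup_star_action \<alpha> x)) = UNIV" by blast
  then show ?thesis
    by (simp add: unital_action_def inverse_semigroup_action_def one semigroup_star_action_mult
        semigroup_star_action_star partial_automorphism_semigroup_star_action)
qed

lemma action_on_generators_semigroup_star_action: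
  "action_on_generators (semigroup_star_action \<alpha>) = \<alpha>"
  by (simp add: action_on_generators_def semigroup_star_action_gen fun_eq_iff)

end


section \<open>Restricting a unital action to the generators\<close>

context
  fixes \<beta> :: "'s::monoid_mult semigroup_star \<Rightarrow> 'a::cstar_algebra \<rightharpoonup> 'a"
  assumes action: "unital_action \<beta>"
begin

lemma unital_actionD:
  shows unital_action_partial_automorphism: "partial_automorphism (\<beta> x)"
    and unital_action_mult: "\<beta> (x * y) = \<beta> x \<circ>\<^sub>m \<beta> y"
    and unital_action_star: "\<beta> (star x) = partial_inverse (\<beta> x)"
    and unital_action_one: "\<beta> 1 = Some"
  using action by (auto simp: unital_action_def inverse_semigroup_action_def)

lemma unital_action_gen: "\<beta> (gen p) = (\<lambda>x. Some (action_on_generators \<beta> p x))"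
proof
  fix x
  have "(\<beta> (star (gen p)) \<circ>\<^sub>m \<beta> (gen p)) x = Some x"
    by (simp add: star_gen_gen unital_action_one flip: unital_action_mult)
  \<comment> \<open>A composite defined at \<open>x\<close> forces its inner map to be defined
    there.\<close>
  then obtain y where "\<beta> (gen p) x = Some y" by (auto simp: map_comp_Some_iff)
  then show "\<beta> (gen p) x = Some (action_on_generators \<beta> p x)"
    by (simp add: action_on_generators_def)
qed

lemma injective_ideal_action_on_generators: "injective_ideal_action (action_on_generators \<beta>)"
proof -
  have dom: "dom (\<beta> (gen p)) = UNIV" for p by (simp add: unital_action_gen)
  have ran: "ran (\<beta> (gen p)) = range (action_on_generators \<beta> p)" for p
    by (auto simp: ran_def unital_action_gen)
  have "star_hom_on UNIV (action_on_generators \<beta> p)" for p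
    using partial_automorphism_hom[OF unital_action_partial_automorphism[of "gen p"]]
    by (simp add: unital_action_gen)
  moreover have "inj (action_on_generators \<beta> p)" for p
    using partial_automorphism_inj[OF unital_action_partial_automorphism[of "gen p"]]
    by (simp add: unital_action_gen inj_on_def)
  moreover have "closed_star_ideal (range (action_on_generators \<beta> p))" for p
    using partial_automorphism_ran[OF unital_action_partial_automorphism[of "gen p"]]
    by (simp add: ran)
  moreover have "action_on_generators \<beta> (p * q) = action_on_generators \<beta> p \<circ> action_on_generators \<beta> q"
    for p q
    using unital_action_mult[of "gen p" "gen q"]
    by (simp add: gen_mult unital_action_gen fun_eq_iff)
  ultimately show ?thesis by (simp add: injective_ideal_action_def)
qed

end

lemma unital_action_eqI:
  assumes \<beta>: "unital_action \<beta>" and \<gamma>: "unital_action \<gamma>"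
    and eq: "action_on_generators \<beta> = action_on_generators \<gamma>"
  shows "\<beta> = \<gamma>"
proof
  fix x
  show "\<beta> x = \<gamma> x"
    by (induction x rule: semigroup_star_induct)
      (simp_all add: unital_action_gen[OF \<beta>] unital_action_gen[OF \<gamma>] eq
        unital_action_mult[OF \<beta>] unital_action_mult[OF \<gamma>]
        unital_action_star[OF \<beta>] unital_action_star[OF \<gamma>])
qed

theorem lemma7p5:
  assumes left_cancellative: "\<And>s t u :: 's::monoid_mult. s * t = s * u \<Longrightarrow> t = u"
  shows "(\<forall>\<beta> :: 's semigroup_star \<Rightarrow> 'a::cstar_algebra \<rightharpoonup> 'a. unital_action \<beta> \<longrightarrow>
            (\<forall>p. \<beta> (gen p) = (\<lambda>x. Some (action_on_generators \<beta> p x)))) \<and>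
         bij_betw action_on_generators
           {\<beta> :: 's semigroup_star \<Rightarrow> 'a \<rightharpoonup> 'a. unital_action \<beta>}
           {\<alpha> :: 's \<Rightarrow> 'a \<Rightarrow> 'a. injective_ideal_action \<alpha>}"
proof
  show "\<forall>\<beta> :: 's semigroup_star \<Rightarrow> 'a \<rightharpoonup> 'a. unital_action \<beta> \<longrightarrow>
      (\<forall>p. \<beta> (gen p) = (\<lambda>x. Some (action_on_generators \<beta> p x)))"
    using unital_action_gen by blast
  show "bij_betw action_on_generators
      {\<beta> :: 's semigroup_star \<Rightarrow> 'a \<rightharpoonup> 'a. unital_action \<beta>}
      {\<alpha> :: 's \<Rightarrow> 'a \<Rightarrow> 'a. injective_ideal_action \<alpha>}"
    \<comment> \<open>Restricting an extension returns the given family. Extending a restriction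
      returns the given action by \<open>unital_action_eqI\<close>, since the two agree on
      generators.\<close>
    by (rule bij_betw_byWitness[where f' = semigroup_star_action])
      (auto intro: unital_action_eqI simp: injective_ideal_action_on_generators
        unital_action_semigroup_star_action action_on_generators_semigroup_star_action)
qed

end
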